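(* Let $U$ be an interval, $I=(a,b)$ an open interval, and $(k_\alpha)_{\alpha\in I}$ a family of functions with $k_\alpha\in\mathcal{C}^{2\neq}(U)$ for all $\alpha\in I$. Suppose that there is a dense subset $X$ of $U$ such that for every $x\in X$ the mapping $I\ni\alpha\mapsto A(k_\alpha)(x)\in\mathbb{R}$ is increasing and one-to-one, and that for every $x\in U$ this mapping is onto $\mathbb{R}$. Then $(\mathfrak{M}_{k_\alpha})_{\alpha\in I}$ is an increasing scale on $U$.
   Context: For an interval $U$, $\mathcal{C}^{2\neq}(U)$ denotes the class of functions in $\mathcal{C}^2(U)$ (real-valued) whose first derivative vanishes nowhere in $U$. For $f\in\mathcal{C}^{2\neq}(U)$ put $A(f)=f''/f'\in\mathcal{C}(U)$. For a continuous strictly monotone $f\colon U\to\mathbb{R}$, a vector $\underline{a}=(a_1,\dots,a_n)\in U^n$ and weights $\underline{w}=(w_1,\dots,w_n)$ ($w_i>0$, $\sum_i w_i=1$), the quasi-arithmetic mean is $\mathfrak{M}_f(\underline{a},\underline{w})=f^{-1}\bigl(\sum_{i=1}^n w_i f(a_i)\bigr)$. A family $(\mathfrak{M}_{k_\alpha})_{\alpha\in I}$ is a scale on $U$ if for every non-constant vector $\underline{a}$ with values in $U$ (of any finite length $n$) and every corresponding weights $\underline{w}$, the mapping $I\ni\alpha\mapsto\mathfrak{M}_{k_\alpha}(\underline{a},\underline{w})$ is a bijection onto $(\min\underline{a},\max\underline{a})$. It is an increasing scale if these mappings are all increasing. *)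

theory Defs
  imports "HOL-Analysis.Analysis"
begin

text \<open>Derivative relative to \<open>U\<close>: one-sided at an endpoint that belongs to \<open>U\<close>.\<close>

definition deriv_on :: "real set \<Rightarrow> (real \<Rightarrow> real) \<Rightarrow> real \<Rightarrow> real" where
  "deriv_on U f x = vector_derivative f (at x within U)"

definition C2_nonvanishing :: "real set \<Rightarrow> (real \<Rightarrow> real) set" where
  "C2_nonvanishing U =
    {f. f differentiable_on U \<and> deriv_on U f differentiable_on U \<and>
        continuous_on U (deriv_on U (deriv_on U f)) \<and>
        (\<forall>x\<in>U. deriv_on U f x \<noteq> 0)}"

definition A_op :: "real set \<Rightarrow> (real \<Rightarrow> real) \<Rightarrow> real \<Rightarrow> real" where
  "A_op U f x = deriv_on U (deriv_on U f) x / deriv_on U f x"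

text \<open>A vector of length \<open>n\<close> is the restriction of a function to \<open>{..<n}\<close>. The mean is
  meaningful for \<open>f\<close> continuous and strictly monotone on \<open>U\<close>, entries of \<open>a\<close> in \<open>U\<close>, and
  \<open>w\<close> satisfying \<open>weights n w\<close>.\<close>

definition weights :: "nat \<Rightarrow> (nat \<Rightarrow> real) \<Rightarrow> bool" where
  "weights n w \<longleftrightarrow> (\<forall>i<n. w i > 0) \<and> (\<Sum>i<n. w i) = 1"

definition qa_mean ::
  "real set \<Rightarrow> (real \<Rightarrow> real) \<Rightarrow> nat \<Rightarrow> (nat \<Rightarrow> real) \<Rightarrow> (nat \<Rightarrow> real) \<Rightarrow> real" where
  "qa_mean U f n a w = inv_into U f (\<Sum>i<n. w i * f (a i))"

definition nonconstant_vector :: "real set \<Rightarrow> nat \<Rightarrow> (nat \<Rightarrow> real) \<Rightarrow> bool" where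
  "nonconstant_vector U n a \<longleftrightarrow> (\<forall>i<n. a i \<in> U) \<and> (\<exists>i<n. \<exists>j<n. a i \<noteq> a j)"

definition is_scale :: "real set \<Rightarrow> real set \<Rightarrow> (real \<Rightarrow> real \<Rightarrow> real) \<Rightarrow> bool" where
  "is_scale U I k \<longleftrightarrow>
    (\<forall>n a w. nonconstant_vector U n a \<longrightarrow> weights n w \<longrightarrow>
       bij_betw (\<lambda>\<alpha>. qa_mean U (k \<alpha>) n a w) I {Min (a ` {..<n})<..<Max (a ` {..<n})})"

definition is_increasing_scale :: "real set \<Rightarrow> real set \<Rightarrow> (real \<Rightarrow> real \<Rightarrow> real) \<Rightarrow> bool" where
  "is_increasing_scale U I k \<longleftrightarrow>
    is_scale U I k \<and>
    (\<forall>n a w. nonconstant_vector U n a \<longrightarrow> weights n w \<longrightarrow>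
       mono_on I (\<lambda>\<alpha>. qa_mean U (k \<alpha>) n a w))"

end

theory Submission
  imports Defs
begin

text \<open>
  A quasi-arithmetic mean does not change when its generator is composed with an affine
  bijection, so for a chosen point \<open>y\<close> the generator may be replaced by
  \<open>N(x) = (k x - k y) / k' y\<close>.  This is the solution of the initial value problem
  \<open>N'' = A(k) N'\<close>, \<open>N y = 0\<close>, \<open>N' y = 1\<close>, and it is strictly increasing and vanishes only
  at \<open>y\<close>.  Because \<open>N\<close> of the mean is the weighted sum \<open>\<Sum> w\<^sub>i N(a\<^sub>i)\<close>, the sign of that sum
  tells on which side of \<open>y\<close> the mean lies (\<open>normalised_at_qa_mean\<close>).

  The solution is monotone in its coefficient: if \<open>A \<le> B\<close> everywhere, then the ratio
  of the derivatives of the two solutions increases and equals \<open>1\<close> at \<open>y\<close>.  Hence the solution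
  for \<open>B\<close> has the larger slope to the right of \<open>y\<close>, the smaller slope to the left, and larger
  values everywhere, strictly so away from \<open>y\<close> if \<open>A < B\<close> on a dense set
  (\<open>normal_generator_mono\<close>, \<open>normal_generator_strict\<close>).  In the theorem, density of \<open>X\<close> and
  continuity give \<open>A(k\<^sub>\<alpha>) \<le> A(k\<^sub>\<beta>)\<close> on all of \<open>U\<close> for \<open>\<alpha> < \<beta>\<close>.  Taking for \<open>y\<close> the mean at
  \<open>\<alpha>\<close>, the weighted sum is \<open>0\<close> at \<open>\<alpha>\<close> and positive at \<open>\<beta>\<close>, so the means increase strictly.

  For surjectivity fix \<open>y\<close> strictly between the extreme entries, and let \<open>\<Phi>(\<alpha>)\<close> be the weighted sum
  normalised at \<open>y\<close>; a zero of \<open>\<Phi>\<close> is a parameter with mean \<open>y\<close>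
  (\<open>balanced_parameter_exists\<close>).  As the values \<open>A(k\<^sub>\<alpha>)(x)\<close> fill the real line at every point \<open>x\<close>,
  monotonicity in \<open>\<alpha>\<close> and a Dini argument
  (\<open>directed_family_exceeds_on_compact\<close>) make this uniform on the compact segment spanned by the
  entries.  So \<open>A(k\<^sub>\<alpha>)\<close> can be pushed above \<open>C\<close> or below \<open>- C\<close> for
  every \<open>C\<close>, where comparison with exponentials gives \<open>\<Phi>\<close> both signs; and moving \<open>\<alpha>\<close> slightly changes
  \<open>A(k\<^sub>\<alpha>)\<close> uniformly little, so that the increasing function \<open>\<Phi>\<close> has no jump at which it could skip \<open>0\<close>.
\<close>

section \<open>Normalised generators\<close>

text \<open>The solution of \<open>f'' = A f'\<close>, \<open>f y = 0\<close>, \<open>f' y = 1\<close>.  With \<open>S\<close> and \<open>A\<close> as free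
  parameters, members of the family can be compared with each other, with explicit exponentials,
  and on subsegments, where a derivative within the segment is all that is left.\<close>

definition normal_generator ::
  "real set \<Rightarrow> real \<Rightarrow> (real \<Rightarrow> real) \<Rightarrow> (real \<Rightarrow> real) \<Rightarrow> bool" where
  "normal_generator S y A f \<longleftrightarrow> f y = 0 \<and>
    (\<exists>f'. f' y = 1 \<and> (\<forall>x\<in>S. 0 < f' x \<and> (f has_real_derivative f' x) (at x within S) \<and>
       (f' has_real_derivative A x * f' x) (at x within S)))"

lemma normal_generator_subset:
  assumes "normal_generator S y A f" "T \<subseteq> S"
  shows "normal_generator T y A f"
  using assms unfolding normal_generator_def
  by (meson DERIV_subset subsetD)

lemma normal_generator_zero: "normal_generator S y A f \<Longrightarrow> f y = 0"
  by (simp add: normal_generator_def)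

text \<open>The segment version of the mean value theorem, free of the order of the two points: the
  arguments below run to the left of \<open>y\<close> as well as to the right.\<close>

lemma interval_mvt:
  fixes f f' :: "real \<Rightarrow> real"
  assumes S: "is_interval S" "u \<in> S" "v \<in> S" "u \<noteq> v"
    and der: "\<And>x. x \<in> S \<Longrightarrow> (f has_real_derivative f' x) (at x within S)"
  obtains z where "z \<in> open_segment u v" "z \<in> S" "f v - f u = f' z * (v - u)"
proof -
  have ordered: "\<exists>z\<in>{p<..<q}. z \<in> S \<and> f q - f p = f' z * (q - p)"
    if "p \<in> S" "q \<in> S" "p < q" for p q
  proof -
    have sub: "{p..q} \<subseteq> S"
      using S(1) that by (meson atLeastAtMost_iff mem_is_interval_1_I subsetI)
    have "\<exists>z\<in>{p<..<q}. f q - f p = (*) (f' z) (q - p)"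
    proof (rule mvt_simple[OF that(3), where f = f and f' = "\<lambda>z. (*) (f' z)"])
      fix x assume "p \<le> x" "x \<le> q"
      then have "x \<in> S" using sub by auto
      then show "(f has_derivative (*) (f' x)) (at x within {p..q})"
        using der[of x] sub DERIV_subset has_field_derivative_def by blast
    qed
    then show ?thesis using sub by (metis greaterThanLessThan_subseteq_atLeastAtMost_iff order_refl subsetD)
  qed
  show thesis
  proof (cases "u < v")
    case True
    then show ?thesis using ordered[OF S(2,3)] that by (auto simp: open_segment_eq_real_ivl)
  next
    case False
    then obtain z where "z \<in> {v<..<u}" "z \<in> S" "f u - f v = f' z * (u - v)"
      using ordered[OF S(3,2)] S(4) by auto
    then show ?thesis using that[of z] False by (auto simp: open_segment_eq_real_ivl algebra_simps)
  qed
qed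

lemma normal_generator_strict_mono:
  assumes gen: "normal_generator S y A f" and S: "is_interval S"
  shows "strict_mono_on S f"
proof (rule strict_mono_onI)
  fix u v assume uv: "u \<in> S" "v \<in> S" "u < v"
  obtain f' where f': "\<And>x. x \<in> S \<Longrightarrow> 0 < f' x"
    "\<And>x. x \<in> S \<Longrightarrow> (f has_real_derivative f' x) (at x within S)"
    using gen unfolding normal_generator_def by blast
  obtain z where "z \<in> S" "f v - f u = f' z * (v - u)"
    using interval_mvt[OF S uv(1,2) _ f'(2)] uv(3) by blast
  then show "f u < f v" using f'(1)[of z] uv(3)
    by (metis diff_gt_0_iff_gt mult_pos_pos)
qed

lemma normal_generator_pos_iff:
  assumes "normal_generator S y A f" "is_interval S" "y \<in> S" "x \<in> S"
  shows "0 < f x \<longleftrightarrow> y < x"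
  using normal_generator_strict_mono[OF assms(1,2)] assms(3,4) normal_generator_zero[OF assms(1)]
  by (metis strict_mono_on_less)

lemma normal_generator_neg_iff:
  assumes "normal_generator S y A f" "is_interval S" "y \<in> S" "x \<in> S"
  shows "f x < 0 \<longleftrightarrow> x < y"
  using normal_generator_strict_mono[OF assms(1,2)] assms(3,4) normal_generator_zero[OF assms(1)]
  by (metis strict_mono_on_less)

text \<open>Everything about two solutions is contained in \<open>h = ln (g' / f')\<close>, since
  \<open>g'' / g' - f'' / f' = B - A\<close>.  Cauchy's mean value theorem turns the quotient of derivatives
  into the quotient of the functions, so that integrals are avoided.\<close>

lemma normal_generator_ratio:
  assumes f: "normal_generator S y A f" and g: "normal_generator S y B g"
    and S: "is_interval S" and y: "y \<in> S" and x: "x \<in> S" "x \<noteq> y"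
  obtains h \<xi> where "h y = 0" "\<And>t. t \<in> S \<Longrightarrow> (h has_real_derivative B t - A t) (at t within S)"
    "\<xi> \<in> S" "\<xi> \<in> open_segment y x" "g x = f x * exp (h \<xi>)"
proof -
  obtain f' where f': "f' y = 1" "\<And>x. x \<in> S \<Longrightarrow> 0 < f' x"
    "\<And>x. x \<in> S \<Longrightarrow> (f has_real_derivative f' x) (at x within S)"
    "\<And>x. x \<in> S \<Longrightarrow> (f' has_real_derivative A x * f' x) (at x within S)"
    using f unfolding normal_generator_def by blast
  obtain g' where g': "g' y = 1" "\<And>x. x \<in> S \<Longrightarrow> 0 < g' x"
    "\<And>x. x \<in> S \<Longrightarrow> (g has_real_derivative g' x) (at x within S)"
    "\<And>x. x \<in> S \<Longrightarrow> (g' has_real_derivative B x * g' x) (at x within S)"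
    using g unfolding normal_generator_def by blast
  define h where "h t = ln (g' t) - ln (f' t)" for t
  have h0: "h y = 0" using f' g' by (simp add: h_def)
  have hd: "(h has_real_derivative B t - A t) (at t within S)" if "t \<in> S" for t
  proof -
    have "((\<lambda>t. ln (g' t) - ln (f' t)) has_real_derivative
        (B t * g' t) * (1 / g' t) - (A t * f' t) * (1 / f' t)) (at t within S)"
      using f'(2,4)[OF that] g'(2,4)[OF that]
      by (auto intro!: derivative_eq_intros)
    then show ?thesis
      using f'(2)[OF that] g'(2)[OF that] by (simp add: h_def[abs_def])
  qed
  \<comment> \<open>Rolle's theorem for \<open>f t * g x - g t * f x\<close>, which vanishes at \<open>x\<close> and at \<open>y\<close>.\<close>
  obtain \<xi> where xi: "\<xi> \<in> open_segment y x" "\<xi> \<in> S"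
    and "(f x * g x - g x * f x) - (f y * g x - g y * f x) = (f' \<xi> * g x - g' \<xi> * f x) * (x - y)"
  proof (rule interval_mvt[OF S y x(1), where f = "\<lambda>t. f t * g x - g t * f x"
          and f' = "\<lambda>t. f' t * g x - g' t * f x"])
    show "y \<noteq> x" using x by simp
    show "((\<lambda>t. f t * g x - g t * f x) has_real_derivative f' t * g x - g' t * f x) (at t within S)"
      if "t \<in> S" for t
      using f'(3)[OF that] g'(3)[OF that] by (auto intro!: derivative_eq_intros)
  qed (use that in auto)
  then have "f' \<xi> * g x = g' \<xi> * f x"
    using f g x by (auto simp: normal_generator_def)
  moreover have "exp (h \<xi>) = g' \<xi> / f' \<xi>"
    using f'(2)[OF xi(2)] g'(2)[OF xi(2)] by (simp add: h_def exp_diff)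
  moreover have "g x = f x * (g' \<xi> / f' \<xi>)" if "f' \<xi> * g x = g' \<xi> * f x"
    using f'(2)[OF xi(2)] that by (simp add: field_simps)
  ultimately have "g x = f x * exp (h \<xi>)" by simp
  then show thesis using that h0 hd xi by blast
qed

text \<open>Here \<open>h \<xi>\<close> is \<open>\<xi> - y\<close> times a value of \<open>B - A\<close>, and \<open>\<xi>\<close> lies between \<open>y\<close> and \<open>x\<close>.  The
  factor \<open>exp (c * (x - y))\<close> suits both sides: to the left of \<open>y\<close> it is less than \<open>1\<close>, but there it
  multiplies a negative number.  The case \<open>c = 0\<close> is monotonicity, a small
  \<open>c\<close> expresses continuous dependence on the coefficient.\<close>

lemma normal_generator_compare:
  assumes f: "normal_generator S y A f" and g: "normal_generator S y B g"
    and S: "is_interval S" "y \<in> S" "x \<in> S"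
    and le: "\<And>t. t \<in> S \<Longrightarrow> B t \<le> A t + c" and c: "0 \<le> c"
  shows "g x \<le> f x * exp (c * (x - y))"
proof (cases "x = y")
  case True
  then show ?thesis using f g by (simp add: normal_generator_def)
next
  case False
  obtain h \<xi> where h: "h y = 0" "\<And>t. t \<in> S \<Longrightarrow> (h has_real_derivative B t - A t) (at t within S)"
    and xi: "\<xi> \<in> S" "\<xi> \<in> open_segment y x" and gx: "g x = f x * exp (h \<xi>)"
    using normal_generator_ratio[OF f g S False] by blast
  have "y \<noteq> \<xi>" using xi(2) by (auto simp: open_segment_def)
  then obtain z where z: "z \<in> S" "h \<xi> - h y = (B z - A z) * (\<xi> - y)"
    using interval_mvt[OF S(1,2) xi(1) _ h(2)] by blast
  have hz: "h \<xi> = (B z - A z) * (\<xi> - y)" using z h by simp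
  have Dz: "B z - A z \<le> c" using le[OF z(1)] by simp
  show ?thesis
  proof (cases "y < x")
    case True
    then have "0 \<le> \<xi> - y" "\<xi> - y \<le> x - y" using xi(2) by (auto simp: open_segment_eq_real_ivl)
    then have "h \<xi> \<le> c * (x - y)" unfolding hz
      by (meson Dz c mult_left_mono mult_right_mono order_trans)
    moreover have "0 < f x" using normal_generator_pos_iff[OF f S] True by simp
    ultimately show ?thesis by (simp add: gx)
  next
    case left: False
    then have "\<xi> - y \<le> 0" "x - y \<le> \<xi> - y" using xi(2) False by (auto simp: open_segment_eq_real_ivl)
    then have "c * (x - y) \<le> h \<xi>" unfolding hz
      by (meson Dz c mult_left_mono mult_right_mono_neg order_trans)
    moreover have "f x < 0" using normal_generator_neg_iff[OF f S] left False by simp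
    ultimately show ?thesis by (simp add: gx)
  qed
qed

lemma normal_generator_mono:
  assumes "normal_generator S y A f" "normal_generator S y B g"
    and "is_interval S" "y \<in> S" "x \<in> S"
    and "\<And>t. t \<in> S \<Longrightarrow> A t \<le> B t"
  shows "f x \<le> g x"
  using normal_generator_compare[OF assms(2,1,3-5), of 0] assms(6) by simp

text \<open>One point with positive derivative already forbids equality at the end points, since a
  nondecreasing function with equal values there is constant in between.\<close>

lemma less_of_nonneg_derivative_pos_somewhere:
  fixes h h' :: "real \<Rightarrow> real"
  assumes S: "is_interval S" "u \<in> S" "v \<in> S" "u < v"
    and der: "\<And>t. t \<in> S \<Longrightarrow> (h has_real_derivative h' t) (at t within S)"
    and nonneg: "\<And>t. t \<in> S \<Longrightarrow> 0 \<le> h' t"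
    and p: "u < p" "p < v" "0 < h' p"
  shows "h u < h v"
proof -
  have mono: "h s \<le> h t" if st: "s \<in> S" "t \<in> S" "s \<le> t" for s t
  proof (cases "s = t")
    case False
    then obtain z where "z \<in> S" "h t - h s = h' z * (t - s)"
      using interval_mvt[OF S(1) st(1,2) _ der] by blast
    then show ?thesis using nonneg[of z] st(3)
      by (metis diff_ge_0_iff_ge mult_nonneg_nonneg)
  qed simp
  have sub: "{u..v} \<subseteq> S"
    using S by (meson atLeastAtMost_iff mem_is_interval_1_I subsetI)
  have "h u \<noteq> h v"
  proof
    assume eq: "h u = h v"
    have const: "h t = h u" if "t \<in> {u<..<v}" for t
    proof -
      have "t \<in> S" using sub that by auto
      then show ?thesis
        using mono[OF S(2), of t] mono[OF _ S(3), of t] that eq by simp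
    qed
    have pS: "p \<in> S" using sub p by auto
    have "{u<..<v} \<subseteq> S" using sub by (simp add: subset_iff)
    then have "(h has_real_derivative h' p) (at p within {u<..<v})"
      by (rule DERIV_subset[OF der[OF pS]])
    then have "(h has_real_derivative h' p) (at p)"
      using at_within_open[of p "{u<..<v}"] p(1,2) by simp
    moreover have "(h has_real_derivative 0) (at p)"
      by (rule has_field_derivative_transform_within_open[of "\<lambda>_. h u" _ _ "{u<..<v}"])
        (use p(1,2) const in auto)
    ultimately have "h' p = 0" by (rule DERIV_unique)
    then show False using p(3) by simp
  qed
  then show ?thesis using mono[OF S(2,3)] S(4) by simp
qed

lemma normal_generator_strict:
  assumes f: "normal_generator S y A f" and g: "normal_generator S y B g"
    and S: "is_interval S" "y \<in> S" "x \<in> S" "x \<noteq> y"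
    and le: "\<And>t. t \<in> S \<Longrightarrow> A t \<le> B t"
    and dense: "\<And>u v. u \<in> S \<Longrightarrow> v \<in> S \<Longrightarrow> u < v \<Longrightarrow> \<exists>p. u < p \<and> p < v \<and> A p < B p"
  shows "f x < g x"
proof -
  obtain h \<xi> where h: "h y = 0" "\<And>t. t \<in> S \<Longrightarrow> (h has_real_derivative B t - A t) (at t within S)"
    and xi: "\<xi> \<in> S" "\<xi> \<in> open_segment y x" and gx: "g x = f x * exp (h \<xi>)"
    using normal_generator_ratio[OF f g S] by blast
  have inc: "h u < h v" if uv: "u \<in> S" "v \<in> S" "u < v" for u v
  proof -
    obtain p where "u < p" "p < v" "A p < B p" using dense[OF uv] by blast
    then show ?thesis
      using less_of_nonneg_derivative_pos_somewhere[OF S(1) uv h(2)] le by simp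
  qed
  show ?thesis
  proof (cases "y < x")
    case True
    then have "0 < h \<xi>" using inc[OF S(2) xi(1)] xi(2) h(1) by (simp add: open_segment_eq_real_ivl)
    then show ?thesis using normal_generator_pos_iff[OF f S(1-3)] True by (simp add: gx)
  next
    case False
    then have "h \<xi> < 0" using inc[OF xi(1) S(2)] xi(2) h(1) S(4) False by (simp add: open_segment_eq_real_ivl)
    then show ?thesis using normal_generator_neg_iff[OF f S(1-3)] False S(4) by (simp add: gx)
  qed
qed

text \<open>Constant coefficients give the explicit solutions used as barriers for large \<open>\<bar>C\<bar>\<close>.\<close>

lemma normal_generator_exp:
  assumes "C \<noteq> 0"
  shows "normal_generator S y (\<lambda>_. C) (\<lambda>x. (exp (C * (x - y)) - 1) / C)"
  unfolding normal_generator_def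
  by (rule conjI, simp, rule exI[of _ "\<lambda>x. exp (C * (x - y))"])
    (use assms in \<open>auto intro!: derivative_eq_intros\<close>)

text \<open>For the constant coefficient \<open>C\<close> the weighted sum of the generator is
  \<open>((\<Sum> w\<^sub>i exp (C (a\<^sub>i - y))) - 1) / C\<close>; for suitable \<open>C\<close> a single entry above \<open>y\<close> outweighs all
  the others.\<close>

lemma exp_sum_exceeds_one:
  fixes w a :: "nat \<Rightarrow> real"
  assumes w: "weights n w" and j: "j < n" "y < a j"
  obtains C where "0 < C" "1 < (\<Sum>i<n. w i * exp (C * (a i - y)))"
proof -
  \<comment> \<open>Chosen so that \<open>exp t > t\<close> alone makes the \<open>j\<close>-th term exceed \<open>1\<close>.\<close>
  define C where "C = 1 / (w j * (a j - y))"
  have wj: "0 < w j" using w j by (simp add: weights_def)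
  have C: "0 < C" using wj j by (simp add: C_def)
  have "1 = w j * (C * (a j - y))" using wj j by (simp add: C_def)
  also have "\<dots> < w j * exp (C * (a j - y))"
    using wj exp_ge_add_one_self[of "C * (a j - y)"]
    by (intro mult_strict_left_mono) linarith+
  also have "\<dots> \<le> (\<Sum>i<n. w i * exp (C * (a i - y)))"
    using w j by (intro member_le_sum) (auto simp: weights_def less_imp_le)
  finally show thesis using that C by blast
qed

section \<open>Compactness and monotonicity in the parameter\<close>

text \<open>The compactness half of Dini's theorem.  Directedness is required in place of monotonicity in
  an ordered index, so that the lemma also serves the negated family, whose order is
  reversed.\<close>

lemma directed_family_exceeds_on_compact:
  fixes \<phi> :: "'i \<Rightarrow> 'a::metric_space \<Rightarrow> real" and u :: "'a \<Rightarrow> real"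
  assumes K: "compact K" and S: "S \<noteq> {}"
    and cont: "\<And>s. s \<in> S \<Longrightarrow> continuous_on K (\<phi> s)" "continuous_on K u"
    and dir: "\<And>s t. s \<in> S \<Longrightarrow> t \<in> S \<Longrightarrow> \<exists>r\<in>S. \<forall>x\<in>K. \<phi> s x \<le> \<phi> r x \<and> \<phi> t x \<le> \<phi> r x"
    and ex: "\<And>x. x \<in> K \<Longrightarrow> \<exists>s\<in>S. u x < \<phi> s x"
  obtains s where "s \<in> S" "\<And>x. x \<in> K \<Longrightarrow> u x < \<phi> s x"
proof -
  have "\<exists>V. open V \<and> V \<inter> K = {x\<in>K. u x < \<phi> s x}" if "s \<in> S" for s
  proof -
    have "continuous_on K (\<lambda>x. \<phi> s x - u x)"
      using cont that by (intro continuous_intros) auto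
    then obtain V where "open V" "V \<inter> K = (\<lambda>x. \<phi> s x - u x) -` {0<..} \<inter> K"
      using continuous_on_open_invariant open_greaterThan by metis
    then show ?thesis by (intro exI[of _ V]) auto
  qed
  then obtain V where V: "\<And>s. s \<in> S \<Longrightarrow> open (V s)"
    "\<And>s. s \<in> S \<Longrightarrow> V s \<inter> K = {x\<in>K. u x < \<phi> s x}"
    by metis
  have "K \<subseteq> (\<Union>s\<in>S. V s)" using ex V(2) by fastforce
  then obtain F where F: "F \<subseteq> S" "finite F" "K \<subseteq> (\<Union>s\<in>F. V s)"
    using compactE_image[OF K, of S V] V(1) by blast
  have "\<exists>r\<in>S. \<forall>s\<in>F. \<forall>x\<in>K. \<phi> s x \<le> \<phi> r x"
    using F(2,1)
  proof (induction rule: finite_induct)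
    case empty
    then show ?case using S by auto
  next
    case (insert s F)
    then obtain r where r: "r \<in> S" "\<forall>s\<in>F. \<forall>x\<in>K. \<phi> s x \<le> \<phi> r x" by auto
    obtain r' where "r' \<in> S" "\<forall>x\<in>K. \<phi> s x \<le> \<phi> r' x \<and> \<phi> r x \<le> \<phi> r' x"
      using dir[of s r] insert r by auto
    then show ?case using r by (intro bexI[of _ r']) force+
  qed
  then obtain r where r: "r \<in> S" "\<forall>s\<in>F. \<forall>x\<in>K. \<phi> s x \<le> \<phi> r x" by blast
  have "u x < \<phi> r x" if "x \<in> K" for x
  proof -
    obtain s where s: "s \<in> F" "x \<in> V s" using F(3) \<open>x \<in> K\<close> by blast
    then have "u x < \<phi> s x" using V(2)[of s] F(1) that by auto
    also have "\<dots> \<le> \<phi> r x" using r(2) s that by auto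
    finally show ?thesis .
  qed
  then show thesis using that r by blast
qed

text \<open>An intermediate value theorem for monotone functions: the supremum of the parameters with
  negative value is a zero, provided that the sets where \<open>\<Phi>\<close> is negative or positive are open at
  their inner ends.  This is what the comparison with a small \<open>c\<close> yields directly.\<close>

lemma mono_zero_crossing:
  fixes \<Phi> :: "real \<Rightarrow> real"
  assumes I: "is_interval I" and mono: "mono_on I \<Phi>"
    and neg: "p \<in> I" "\<Phi> p < 0" and pos: "q \<in> I" "0 < \<Phi> q"
    and right: "\<And>\<beta>. \<beta> \<in> I \<Longrightarrow> \<Phi> \<beta> < 0 \<Longrightarrow> \<exists>\<gamma>\<in>I. \<beta> < \<gamma> \<and> \<Phi> \<gamma> < 0"
    and left: "\<And>\<beta>. \<beta> \<in> I \<Longrightarrow> 0 < \<Phi> \<beta> \<Longrightarrow> \<exists>\<gamma>\<in>I. \<gamma> < \<beta> \<and> 0 < \<Phi> \<gamma>"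
  obtains \<alpha> where "\<alpha> \<in> I" "\<Phi> \<alpha> = 0"
proof -
  define N where "N = {\<alpha>\<in>I. \<Phi> \<alpha> < 0}"
  have bound: "\<alpha> \<le> \<gamma>" if "\<alpha> \<in> N" "\<gamma> \<in> I" "0 < \<Phi> \<gamma>" for \<alpha> \<gamma>
    using that mono_onD[OF mono, of \<gamma> \<alpha>] by (force simp: N_def)
  have pN: "p \<in> N" using neg by (simp add: N_def)
  have bdd: "bdd_above N" using bound pos by (meson bdd_above.I)
  define \<sigma> where "\<sigma> = Sup N"
  have upper: "\<alpha> \<le> \<sigma>" if "\<alpha> \<in> N" for \<alpha> using that bdd by (simp add: \<sigma>_def cSup_upper)
  have least: "\<sigma> \<le> \<gamma>" if "\<gamma> \<in> I" "0 < \<Phi> \<gamma>" for \<gamma>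
    using that bound pN unfolding \<sigma>_def by (metis cSup_least empty_iff)
  have "\<sigma> \<in> I" using upper[OF pN] least[OF pos] I neg(1) pos(1)
    by (meson mem_is_interval_1_I)
  moreover have "\<not> \<Phi> \<sigma> < 0" using right[OF \<open>\<sigma> \<in> I\<close>] upper by (force simp: N_def)
  moreover have "\<not> 0 < \<Phi> \<sigma>" using left[OF \<open>\<sigma> \<in> I\<close>] least by force
  ultimately show thesis using that by force
qed

lemma dense_le_extend:
  fixes f g :: "real \<Rightarrow> real"
  assumes "continuous_on U f" "continuous_on U g" and X: "X \<subseteq> U" "U \<subseteq> closure X"
    and le: "\<And>x. x \<in> X \<Longrightarrow> f x \<le> g x" and x: "x \<in> U"
  shows "f x \<le> g x"
proof -
  obtain s where s: "\<And>n. s n \<in> X" "s \<longlonglongrightarrow> x"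
    using X(2) x closure_sequential by blast
  have "(\<lambda>n. f (s n)) \<longlonglongrightarrow> f x" "(\<lambda>n. g (s n)) \<longlonglongrightarrow> g x"
    using continuous_on_tendsto_compose[OF assms(1) s(2) x] continuous_on_tendsto_compose[OF assms(2) s(2) x]
      s(1) X(1) by (simp_all add: subset_iff)
  then show ?thesis using s(1) le by (intro LIMSEQ_le) auto
qed

section \<open>Quasi-arithmetic means through normalised generators\<close>

definition normalised_at :: "real set \<Rightarrow> real \<Rightarrow> (real \<Rightarrow> real) \<Rightarrow> real \<Rightarrow> real" where
  "normalised_at U y k x = (k x - k y) / deriv_on U k y"

text \<open>The derivative \<open>k'\<close> is continuous without zeros on an interval and hence of constant sign;
  dividing by \<open>k' y\<close> makes it positive, whether \<open>k\<close> increases or decreases.\<close>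

lemma normal_generator_normalised_at:
  assumes U: "is_interval U" and k: "k \<in> C2_nonvanishing U" and y: "y \<in> U"
  shows "normal_generator U y (A_op U k) (normalised_at U y k)"
proof -
  let ?k' = "deriv_on U k"
  have works: "(f has_real_derivative deriv_on U f x) (at x within U)"
    if "f differentiable_on U" "x \<in> U" for f x
    using that unfolding deriv_on_def differentiable_on_def
    by (simp add: has_real_derivative_iff_has_vector_derivative vector_derivative_works)
  have nz: "\<And>x. x \<in> U \<Longrightarrow> ?k' x \<noteq> 0"
    and d1: "\<And>x. x \<in> U \<Longrightarrow> (k has_real_derivative ?k' x) (at x within U)"
    and d2: "\<And>x. x \<in> U \<Longrightarrow> (?k' has_real_derivative deriv_on U ?k' x) (at x within U)"
    and cont: "continuous_on U ?k'"
    using k works differentiable_imp_continuous_on by (auto simp: C2_nonvanishing_def)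
  have "0 < ?k' x / ?k' y" if x: "x \<in> U" for x
  proof (rule ccontr)
    assume "\<not> 0 < ?k' x / ?k' y"
    moreover have "connected ((\<lambda>x. ?k' x / ?k' y) ` U)"
      using U cont nz[OF y] by (intro connected_continuous_image continuous_intros)
        (auto simp: is_interval_connected_1)
    moreover have "?k' y / ?k' y = 1" using nz[OF y] by simp
    ultimately have "0 \<in> (\<lambda>x. ?k' x / ?k' y) ` U"
      using x y connectedD_interval[of "(\<lambda>x. ?k' x / ?k' y) ` U" "?k' x / ?k' y" 1 0]
      by (metis imageI not_less zero_le_one)
    then show False using nz y by auto
  qed
  moreover have "(normalised_at U y k has_real_derivative ?k' x / ?k' y) (at x within U)"
    if "x \<in> U" for x
    unfolding normalised_at_def[abs_def] using d1[OF that] nz[OF y]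
    by (auto intro!: derivative_eq_intros)
  moreover have "((\<lambda>x. ?k' x / ?k' y) has_real_derivative A_op U k x * (?k' x / ?k' y)) (at x within U)"
    if "x \<in> U" for x
    using DERIV_cdivide[OF d2[OF that], of "?k' y"] nz[OF that] by (simp add: A_op_def)
  ultimately show ?thesis
    unfolding normal_generator_def using nz[OF y]
    by (intro conjI exI[of _ "\<lambda>x. ?k' x / ?k' y"]) (auto simp: normalised_at_def)
qed

lemma continuous_on_A_op:
  assumes "k \<in> C2_nonvanishing U"
  shows "continuous_on U (A_op U k)"
  using assms differentiable_imp_continuous_on unfolding A_op_def[abs_def] C2_nonvanishing_def
  by (auto intro!: continuous_intros)

lemma sum_normalised_at:
  assumes "weights n w"
  shows "(\<Sum>i<n. w i * normalised_at U y k (a i)) = ((\<Sum>i<n. w i * k (a i)) - k y) / deriv_on U k y"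
proof -
  have "(\<Sum>i<n. w i * normalised_at U y k (a i)) = (\<Sum>i<n. w i * k (a i) - w i * k y) / deriv_on U k y"
    by (simp add: normalised_at_def sum_divide_distrib algebra_simps)
  also have "(\<Sum>i<n. w i * k (a i) - w i * k y) = (\<Sum>i<n. w i * k (a i)) - k y"
    using assms by (simp add: weights_def sum_subtractf flip: sum_distrib_right)
  finally show ?thesis .
qed

lemma weighted_sum_less:
  assumes "weights n w" "\<And>i. i < n \<Longrightarrow> u i \<le> v i" "j < n" "u j < v j"
  shows "(\<Sum>i<n. w i * u i) < (\<Sum>i<n. w i * v i)"
  using assms by (intro sum_strict_mono_ex1) (auto simp: weights_def less_imp_le)

text \<open>The mean is defined through \<open>inv_into\<close>, which is meaningful only where the weighted sum is
  a value of \<open>k\<close>.  The increasing generator normalised at the smallest entry shows this by the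
  intermediate value theorem, and locates the preimage strictly between the extreme
  entries.\<close>

lemma qa_mean_between:
  assumes U: "is_interval U" and k: "k \<in> C2_nonvanishing U"
    and a: "nonconstant_vector U n a" and w: "weights n w"
  shows "Min (a ` {..<n}) < qa_mean U k n a w" (is "?m < _")
    and "qa_mean U k n a w < Max (a ` {..<n})" (is "_ < ?M")
    and "qa_mean U k n a w \<in> U"
    and "k (qa_mean U k n a w) = (\<Sum>i<n. w i * k (a i))"
proof -
  have n: "{..<n} \<noteq> {}" using a by (auto simp: nonconstant_vector_def)
  then have "?m \<in> a ` {..<n}" "?M \<in> a ` {..<n}" by simp_all
  then obtain i0 i1 where i0: "i0 < n" "a i0 = ?m" and i1: "i1 < n" "a i1 = ?M" by (metis imageE lessThan_iff)
  have bounds: "?m \<le> a i" "a i \<le> ?M" if "i < n" for i using that by simp_all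
  have aU: "\<And>i. i < n \<Longrightarrow> a i \<in> U" using a by (simp add: nonconstant_vector_def)
  have mM: "?m < ?M" using a bounds unfolding nonconstant_vector_def
    by (metis linorder_neqE_linordered_idom order.strict_trans1 order.strict_trans2)
  have m: "?m \<in> U" and M: "?M \<in> U" using i0 i1 aU by metis+
  define f where "f = normalised_at U ?m k"
  have gen: "normal_generator U ?m (A_op U k) f"
    unfolding f_def by (rule normal_generator_normalised_at[OF U k m])
  have mono: "strict_mono_on U f" by (rule normal_generator_strict_mono[OF gen U])
  have le: "f ?m \<le> f (a i)" "f (a i) \<le> f ?M" if "i < n" for i
    using strict_mono_on_leD[OF mono] m M aU[OF that] bounds[OF that] by auto
  have lt: "f ?m < f ?M" using strict_mono_onD[OF mono m M mM] .
  have weighted_const: "(\<Sum>i<n. w i * c) = c" for c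
    using w by (simp add: weights_def flip: sum_distrib_right)
  let ?s = "\<Sum>i<n. w i * f (a i)"
  have "f ?m < ?s" "?s < f ?M"
    using weighted_sum_less[OF w, of "\<lambda>_. f ?m" "\<lambda>i. f (a i)" i1]
      weighted_sum_less[OF w, of "\<lambda>i. f (a i)" "\<lambda>_. f ?M" i0] le lt i0 i1 weighted_const by auto
  moreover have "continuous_on {?m..?M} f"
  proof -
    have "{?m..?M} \<subseteq> U" using U m M by (meson atLeastAtMost_iff mem_is_interval_1_I subsetI)
    moreover have "continuous_on U f"
      using gen unfolding normal_generator_def by (metis DERIV_continuous_on)
    ultimately show ?thesis using continuous_on_subset by blast
  qed
  ultimately obtain y where y: "?m \<le> y" "y \<le> ?M" "f y = ?s"
    using IVT'[of f ?m ?s ?M] mM by auto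
  have y': "?m < y" "y < ?M" using y \<open>f ?m < ?s\<close> \<open>?s < f ?M\<close> by (metis order_le_less order_less_irrefl)+
  have yU: "y \<in> U" using y m M U by (meson mem_is_interval_1_I)
  have nz: "deriv_on U k ?m \<noteq> 0" using k m by (simp add: C2_nonvanishing_def)
  have ky: "k y = (\<Sum>i<n. w i * k (a i))"
    using y(3) nz sum_normalised_at[OF w, of U ?m k a] by (simp add: f_def normalised_at_def)
  have inj: "inj_on k U"
  proof (rule inj_onI)
    fix s t assume "s \<in> U" "t \<in> U" "k s = k t"
    moreover from this have "f s = f t" by (simp add: f_def normalised_at_def)
    ultimately show "s = t" using strict_mono_on_imp_inj_on[OF mono] by (meson inj_onD)
  qed
  have "qa_mean U k n a w = y"
    unfolding qa_mean_def ky[symmetric] by (rule inv_into_f_f[OF inj yU])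
  then show "?m < qa_mean U k n a w" "qa_mean U k n a w < ?M" "qa_mean U k n a w \<in> U"
    "k (qa_mean U k n a w) = (\<Sum>i<n. w i * k (a i))"
    using y' yU ky by simp_all
qed

text \<open>The link between means and signs: the left side is positive, zero or negative according as
  the mean is above, at or below \<open>y\<close>.\<close>

lemma normalised_at_qa_mean:
  assumes "is_interval U" "k \<in> C2_nonvanishing U" "nonconstant_vector U n a" "weights n w"
  shows "normalised_at U y k (qa_mean U k n a w) = (\<Sum>i<n. w i * normalised_at U y k (a i))"
  using qa_mean_between(4)[OF assms] sum_normalised_at[OF assms(4)] by (simp add: normalised_at_def)

text \<open>Surjectivity, freed from means: the sum \<open>\<Phi>\<close> increases with the parameter, takes both signs
  because some entries lie on each side of \<open>y\<close> and the coefficients become uniformly large positive or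
  large negative, and cannot leap over \<open>0\<close> because nearby coefficients are uniformly close.\<close>

lemma balanced_parameter_exists:
  fixes A N :: "real \<Rightarrow> real \<Rightarrow> real"
  assumes K: "compact K" "is_interval K" "y \<in> K" and I: "is_interval I"
    and gen: "\<And>\<alpha>. \<alpha> \<in> I \<Longrightarrow> normal_generator K y (A \<alpha>) (N \<alpha>)"
    and cont: "\<And>\<alpha>. \<alpha> \<in> I \<Longrightarrow> continuous_on K (A \<alpha>)"
    and mono: "\<And>\<alpha> \<beta> x. \<alpha> \<in> I \<Longrightarrow> \<beta> \<in> I \<Longrightarrow> \<alpha> \<le> \<beta> \<Longrightarrow> x \<in> K \<Longrightarrow> A \<alpha> x \<le> A \<beta> x"
    and onto: "\<And>x. x \<in> K \<Longrightarrow> (\<lambda>\<alpha>. A \<alpha> x) ` I = UNIV"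
    and w: "weights n w" and aK: "\<And>i. i < n \<Longrightarrow> a i \<in> K"
    and j: "j < n" "a j < y" and l: "l < n" "y < a l"
  obtains \<alpha> where "\<alpha> \<in> I" "(\<Sum>i<n. w i * N \<alpha> (a i)) = 0"
proof -
  define \<Phi> where "\<Phi> \<alpha> = (\<Sum>i<n. w i * N \<alpha> (a i))" for \<alpha>
  have w0: "0 \<le> w i" if "i < n" for i using w that by (simp add: weights_def less_imp_le)
  have w1: "(\<Sum>i<n. w i) = 1" using w by (simp add: weights_def)
  have attained: "\<exists>\<alpha>\<in>I. A \<alpha> x = c" if "x \<in> K" for x c
    using onto[OF that] by (metis UNIV_I imageE)
  have above: "\<exists>s\<in>T. \<forall>x\<in>K. u x < A s x"
    if T: "T \<subseteq> I" and u: "continuous_on K u" and ex: "\<And>x. x \<in> K \<Longrightarrow> \<exists>s\<in>T. u x < A s x" for T u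
  proof -
    have "\<exists>r\<in>T. \<forall>x\<in>K. A s x \<le> A r x \<and> A t x \<le> A r x" if "s \<in> T" "t \<in> T" for s t
      using that T mono by (intro bexI[of _ "max s t"]) (simp_all add: max_def subset_iff)
    moreover have "continuous_on K (A s)" if "s \<in> T" for s using cont that T by blast
    moreover have "T \<noteq> {}" using ex K(3) by blast
    ultimately obtain s where "s \<in> T" "\<And>x. x \<in> K \<Longrightarrow> u x < A s x"
      using directed_family_exceeds_on_compact[OF K(1), of T A u] u ex by metis
    then show ?thesis by auto
  qed
  have below: "\<exists>s\<in>T. \<forall>x\<in>K. A s x < u x"
    if T: "T \<subseteq> I" and u: "continuous_on K u" and ex: "\<And>x. x \<in> K \<Longrightarrow> \<exists>s\<in>T. A s x < u x" for T u
  proof -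
    have "\<exists>r\<in>T. \<forall>x\<in>K. - A s x \<le> - A r x \<and> - A t x \<le> - A r x" if "s \<in> T" "t \<in> T" for s t
      using that T mono by (intro bexI[of _ "min s t"]) (simp_all add: min_def subset_iff)
    moreover have "continuous_on K (\<lambda>x. - A s x)" if "s \<in> T" for s
      using cont that T by (intro continuous_intros) auto
    moreover have "continuous_on K (\<lambda>x. - u x)" using u by (intro continuous_intros)
    moreover have "T \<noteq> {}" using ex K(3) by blast
    moreover have "\<And>x. x \<in> K \<Longrightarrow> \<exists>s\<in>T. - u x < - A s x" using ex by simp
    ultimately obtain s where "s \<in> T" "\<And>x. x \<in> K \<Longrightarrow> - u x < - A s x"
      using directed_family_exceeds_on_compact[OF K(1), of T "\<lambda>s x. - A s x" "\<lambda>x. - u x"] by metis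
    then show ?thesis by auto
  qed
  have exp_sum: "(\<Sum>i<n. w i * ((exp (C * (a i - y)) - 1) / C)) = ((\<Sum>i<n. w i * exp (C * (a i - y))) - 1) / C" for C
    using w1 by (simp add: right_diff_distrib sum_subtractf flip: sum_divide_distrib)
  have \<Phi>_le: "(\<Sum>i<n. w i * f i) \<le> (\<Sum>i<n. w i * g i)" if "\<And>i. i < n \<Longrightarrow> f i \<le> g i" for f g :: "nat \<Rightarrow> real"
    using that w0 by (intro sum_mono mult_left_mono) auto
  have pos: "\<exists>q\<in>I. 0 < \<Phi> q"
  proof -
    obtain C where C: "0 < C" "1 < (\<Sum>i<n. w i * exp (C * (a i - y)))"
      using exp_sum_exceeds_one[OF w l(1), of y a] l(2) by blast
    \<comment> \<open>A coefficient above \<open>C\<close> gives generators above the exponential one.\<close>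
    have "\<exists>s\<in>I. C < A s x" if "x \<in> K" for x using attained[OF that, of "C + 1"] by force
    then obtain q where q: "q \<in> I" "\<And>x. x \<in> K \<Longrightarrow> C < A q x"
      using above[of I "\<lambda>_. C"] by auto
    have "0 < (\<Sum>i<n. w i * ((exp (C * (a i - y)) - 1) / C))" unfolding exp_sum using C by simp
    also have "\<dots> \<le> \<Phi> q" unfolding \<Phi>_def using C(1) q(2)
      by (intro \<Phi>_le normal_generator_mono[OF normal_generator_exp gen[OF q(1)] K(2,3) aK])
        (auto intro: less_imp_le)
    finally show ?thesis using q(1) by blast
  qed
  have neg: "\<exists>p\<in>I. \<Phi> p < 0"
  proof -
    \<comment> \<open>The mirror image: reflecting the entries at \<open>0\<close> turns \<open>C\<close> into \<open>- C\<close>.\<close>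
    obtain C where C: "0 < C" "1 < (\<Sum>i<n. w i * exp (C * (- a i - - y)))"
      using exp_sum_exceeds_one[OF w j(1), of "- y" "\<lambda>i. - a i"] j(2) by auto
    have "\<exists>s\<in>I. A s x < - C" if "x \<in> K" for x using attained[OF that, of "- C - 1"] by force
    then obtain p where p: "p \<in> I" "\<And>x. x \<in> K \<Longrightarrow> A p x < - C"
      using below[of I "\<lambda>_. - C"] by auto
    have "\<Phi> p \<le> (\<Sum>i<n. w i * ((exp (- C * (a i - y)) - 1) / - C))" unfolding \<Phi>_def using C(1) p(2)
      by (intro \<Phi>_le normal_generator_mono[OF gen[OF p(1)] normal_generator_exp K(2,3) aK])
        (auto intro: less_imp_le)
    also have "\<dots> = ((\<Sum>i<n. w i * exp (C * (- a i - - y))) - 1) / - C"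
      unfolding exp_sum by (simp add: algebra_simps)
    also have "\<dots> < 0" using C by (simp add: divide_pos_neg)
    finally show ?thesis using p(1) by blast
  qed
  have perturb: "((\<lambda>\<epsilon>. \<Sum>i<n. w i * (N \<beta> (a i) * exp (s * \<epsilon> * (a i - y)))) \<longlongrightarrow> \<Phi> \<beta>) (at_right 0)" for s \<beta>
    unfolding \<Phi>_def by (auto intro!: tendsto_eq_intros)
  have right: "\<exists>\<gamma>\<in>I. \<beta> < \<gamma> \<and> \<Phi> \<gamma> < 0" if \<beta>: "\<beta> \<in> I" "\<Phi> \<beta> < 0" for \<beta>
  proof -
    \<comment> \<open>A tolerance \<open>\<epsilon>\<close> so small that the bound of \<open>normal_generator_compare\<close> keeps the sum negative.\<close>
    obtain \<epsilon> where e: "0 < \<epsilon>" "(\<Sum>i<n. w i * (N \<beta> (a i) * exp (1 * \<epsilon> * (a i - y)))) < 0"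
      using eventually_conj[OF order_tendstoD(2)[OF perturb \<beta>(2), of 1] eventually_at_right_less[of 0]]
        eventually_happens'[OF trivial_limit_at_right_real] by blast
    have "\<exists>\<gamma>\<in>I \<inter> {\<beta><..}. A \<gamma> x < A \<beta> x + \<epsilon>" if "x \<in> K" for x
    proof -
      obtain \<gamma> where "\<gamma> \<in> I" "A \<gamma> x = A \<beta> x + \<epsilon> / 2" using attained \<open>x \<in> K\<close> by blast
      then show ?thesis using e(1) mono[OF _ \<beta>(1) _ that, of \<gamma>] by (intro bexI[of _ \<gamma>]) force+
    qed
    moreover have "continuous_on K (\<lambda>x. A \<beta> x + \<epsilon>)" using cont \<beta> by (intro continuous_intros) auto
    ultimately obtain \<gamma> where g: "\<gamma> \<in> I" "\<beta> < \<gamma>" "\<And>x. x \<in> K \<Longrightarrow> A \<gamma> x < A \<beta> x + \<epsilon>"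
      using below[of "I \<inter> {\<beta><..}" "\<lambda>x. A \<beta> x + \<epsilon>"] by auto
    have "\<Phi> \<gamma> \<le> (\<Sum>i<n. w i * (N \<beta> (a i) * exp (1 * \<epsilon> * (a i - y))))" unfolding \<Phi>_def
      using normal_generator_compare[OF gen[OF \<beta>(1)] gen[OF g(1)] K(2,3) aK, of _ \<epsilon>] g(3) e(1)
      by (intro \<Phi>_le) (auto intro: less_imp_le)
    then show ?thesis using g e by force
  qed
  have left: "\<exists>\<gamma>\<in>I. \<gamma> < \<beta> \<and> 0 < \<Phi> \<gamma>" if \<beta>: "\<beta> \<in> I" "0 < \<Phi> \<beta>" for \<beta>
  proof -
    obtain \<epsilon> where e: "0 < \<epsilon>" "0 < (\<Sum>i<n. w i * (N \<beta> (a i) * exp (- 1 * \<epsilon> * (a i - y))))"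
      using eventually_conj[OF order_tendstoD(1)[OF perturb \<beta>(2), of "- 1"] eventually_at_right_less[of 0]]
        eventually_happens'[OF trivial_limit_at_right_real] by blast
    have "\<exists>\<gamma>\<in>I \<inter> {..<\<beta>}. A \<beta> x - \<epsilon> < A \<gamma> x" if "x \<in> K" for x
    proof -
      obtain \<gamma> where "\<gamma> \<in> I" "A \<gamma> x = A \<beta> x - \<epsilon> / 2" using attained \<open>x \<in> K\<close> by blast
      then show ?thesis using e(1) mono[OF \<beta>(1) _ _ that, of \<gamma>] by (intro bexI[of _ \<gamma>]) force+
    qed
    moreover have "continuous_on K (\<lambda>x. A \<beta> x - \<epsilon>)" using cont \<beta> by (intro continuous_intros) auto
    ultimately obtain \<gamma> where g: "\<gamma> \<in> I" "\<gamma> < \<beta>" "\<And>x. x \<in> K \<Longrightarrow> A \<beta> x - \<epsilon> < A \<gamma> x"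
      using above[of "I \<inter> {..<\<beta>}" "\<lambda>x. A \<beta> x - \<epsilon>"] by auto
    have "N \<beta> (a i) * exp (- 1 * \<epsilon> * (a i - y)) \<le> N \<gamma> (a i)" if "i < n" for i
    proof -
      \<comment> \<open>A lower bound for \<open>N \<gamma>\<close> is an upper bound for \<open>N \<beta>\<close>: the two generators change places.\<close>
      have "A \<beta> t \<le> A \<gamma> t + \<epsilon>" if "t \<in> K" for t using g(3)[OF that] by simp
      then have "N \<beta> (a i) \<le> N \<gamma> (a i) * exp (\<epsilon> * (a i - y))"
        using e(1) by (intro normal_generator_compare[OF gen[OF g(1)] gen[OF \<beta>(1)] K(2,3) aK[OF that]]) auto
      then have "N \<beta> (a i) * exp (- (\<epsilon> * (a i - y))) \<le> N \<gamma> (a i) * exp (\<epsilon> * (a i - y)) * exp (- (\<epsilon> * (a i - y)))"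
        by (intro mult_right_mono) auto
      then show ?thesis by (simp add: mult.assoc flip: exp_add)
    qed
    then have "(\<Sum>i<n. w i * (N \<beta> (a i) * exp (- 1 * \<epsilon> * (a i - y)))) \<le> \<Phi> \<gamma>"
      unfolding \<Phi>_def by (rule \<Phi>_le)
    then show ?thesis using g e by force
  qed
  have \<Phi>_mono: "mono_on I \<Phi>"
    unfolding \<Phi>_def
    by (intro mono_onI \<Phi>_le normal_generator_mono[OF gen gen K(2,3) aK]) (auto intro: mono)
  obtain p q where "p \<in> I" "\<Phi> p < 0" "q \<in> I" "0 < \<Phi> q" using pos neg by blast
  then obtain \<alpha> where "\<alpha> \<in> I" "\<Phi> \<alpha> = 0"
    using mono_zero_crossing[OF I \<Phi>_mono _ _ _ _ right left] by blast
  then show thesis using that by (simp add: \<Phi>_def)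
qed

theorem theorem1:
  fixes U I X :: "real set" and a b :: ereal and k :: "real \<Rightarrow> real \<Rightarrow> real"
  assumes "is_interval U"
    and "a < b" and "I = einterval a b"
    and "\<And>\<alpha>. \<alpha> \<in> I \<Longrightarrow> k \<alpha> \<in> C2_nonvanishing U"
    and "X \<subseteq> U" and "U \<subseteq> closure X"
    and "\<And>x. x \<in> X \<Longrightarrow> mono_on I (\<lambda>\<alpha>. A_op U (k \<alpha>) x)"
    and "\<And>x. x \<in> X \<Longrightarrow> inj_on (\<lambda>\<alpha>. A_op U (k \<alpha>) x) I"
    and "\<And>x. x \<in> U \<Longrightarrow> (\<lambda>\<alpha>. A_op U (k \<alpha>) x) ` I = UNIV"
  shows "is_increasing_scale U I k"
proof -
  have mono: "A_op U (k \<alpha>) x \<le> A_op U (k \<beta>) x" if "\<alpha> \<in> I" "\<beta> \<in> I" "\<alpha> \<le> \<beta>" "x \<in> U" for \<alpha> \<beta> x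
    using continuous_on_A_op[OF assms(4)[OF that(1)]] continuous_on_A_op[OF assms(4)[OF that(2)]]
      assms(5,6) _ that(4)
    by (rule dense_le_extend) (use assms(7) that in \<open>auto dest: mono_onD\<close>)
  have strict: "A_op U (k \<alpha>) x < A_op U (k \<beta>) x" if "\<alpha> \<in> I" "\<beta> \<in> I" "\<alpha> < \<beta>" "x \<in> X" for \<alpha> \<beta> x
    using mono[OF that(1,2)] that assms(5) inj_onD[OF assms(8)[OF that(4)], of \<alpha> \<beta>]
    by (metis less_eq_real_def order_less_irrefl subsetD)
  have dense: "\<exists>p\<in>X. u < p \<and> p < v" if uv: "u \<in> U" "v \<in> U" "u < v" for u v
  proof -
    have "(u + v) / 2 \<in> U" using assms(1) uv mem_is_interval_1_I[of U u v "(u + v) / 2"] by simp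
    moreover have "(u + v) / 2 \<in> {u<..<v}" using uv(3) by simp
    ultimately have "{u<..<v} \<inter> closure X \<noteq> {}" using assms(6) by blast
    then show ?thesis using open_Int_closure_eq_empty[of "{u<..<v}" X] by auto
  qed
  have I: "is_interval I"
    unfolding assms(3) is_interval_1 einterval_def
    by (auto intro: less_le_trans) (meson ereal_less_eq(3) le_less_trans)
  have main: "bij_betw (\<lambda>\<alpha>. qa_mean U (k \<alpha>) n v w) I {Min (v ` {..<n})<..<Max (v ` {..<n})} \<and>
      mono_on I (\<lambda>\<alpha>. qa_mean U (k \<alpha>) n v w)"
    if v: "nonconstant_vector U n v" and w: "weights n w" for n v w
  proof -
    let ?m = "Min (v ` {..<n})" and ?M = "Max (v ` {..<n})"
    define Q where "Q \<alpha> = qa_mean U (k \<alpha>) n v w" for \<alpha>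
    note between = qa_mean_between[OF assms(1) assms(4) v w, folded Q_def]
    note gen = normal_generator_normalised_at[OF assms(1) assms(4)]
    note mean = normalised_at_qa_mean[OF assms(1) assms(4) v w, folded Q_def]
    have vU: "v i \<in> U" if "i < n" for i using v that by (simp add: nonconstant_vector_def)
    have "{..<n} \<noteq> {}" using v by (auto simp: nonconstant_vector_def)
    then have "?m \<in> v ` {..<n}" "?M \<in> v ` {..<n}" by simp_all
    then obtain j l where j: "j < n" "v j = ?m" and l: "l < n" "v l = ?M" by (metis imageE lessThan_iff)
    have sub: "{?m..?M} \<subseteq> U"
      using vU[OF j(1)] vU[OF l(1)] assms(1) unfolding j(2) l(2)
      by (meson atLeastAtMost_iff mem_is_interval_1_I subsetI)
    have inc: "Q \<alpha> < Q \<beta>" if ab: "\<alpha> \<in> I" "\<beta> \<in> I" "\<alpha> < \<beta>" for \<alpha> \<beta>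
    proof -
      define y where "y = Q \<alpha>"
      have y: "y \<in> U" "?m < y" using between(1,3)[OF ab(1)] by (simp_all add: y_def)
      \<comment> \<open>Normalised at the mean for \<open>\<alpha>\<close>, the weighted sum vanishes for \<open>\<alpha>\<close> and is positive for \<open>\<beta>\<close>.\<close>
      have less: "normalised_at U y (k \<alpha>) x < normalised_at U y (k \<beta>) x" if "x \<in> U" "x \<noteq> y" for x
        using gen[OF ab(1) y(1)] gen[OF ab(2) y(1)] assms(1) y(1) that
        by (rule normal_generator_strict) (use mono[OF ab(1,2)] strict[OF ab] dense ab(3) in \<open>simp, meson\<close>)
      have zero: "normalised_at U y q y = 0" for q by (simp add: normalised_at_def)
      have "normalised_at U y (k \<alpha>) x \<le> normalised_at U y (k \<beta>) x" if "x \<in> U" for x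
        using less[OF that] zero by (cases "x = y") auto
      then have "normalised_at U y (k \<alpha>) (Q \<alpha>) < normalised_at U y (k \<beta>) (Q \<beta>)"
        unfolding mean[OF ab(1)] mean[OF ab(2)]
        using less[OF vU[OF j(1)]] vU j y(2) by (intro weighted_sum_less[OF w]) auto
      then have "0 < normalised_at U y (k \<beta>) (Q \<beta>)" using zero by (simp add: y_def)
      then show ?thesis
        using normal_generator_pos_iff[OF gen[OF ab(2) y(1)] assms(1) y(1) between(3)[OF ab(2)]]
        by (simp add: y_def)
    qed
    have hit: "y \<in> Q ` I" if y: "?m < y" "y < ?M" for y
    proof -
      have yK: "y \<in> {?m..?M}" using y by simp
      then have yU: "y \<in> U" using sub by blast
      obtain \<alpha> where \<alpha>: "\<alpha> \<in> I" "(\<Sum>i<n. w i * normalised_at U y (k \<alpha>) (v i)) = 0"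
      proof (rule balanced_parameter_exists[OF compact_Icc is_interval_cc yK I, where
            A = "\<lambda>\<alpha>. A_op U (k \<alpha>)" and N = "\<lambda>\<alpha>. normalised_at U y (k \<alpha>)" and w = w and a = v
            and n = n and j = j and l = l])
        show "normal_generator {?m..?M} y (A_op U (k \<alpha>)) (normalised_at U y (k \<alpha>))" if "\<alpha> \<in> I" for \<alpha>
          using normal_generator_subset[OF gen[OF that yU] sub] .
        show "continuous_on {?m..?M} (A_op U (k \<alpha>))" if "\<alpha> \<in> I" for \<alpha>
          using continuous_on_subset[OF continuous_on_A_op[OF assms(4)[OF that]] sub] .
      qed (use mono sub assms(9) w j l y in \<open>auto simp: subset_iff\<close>)
      have "normalised_at U y (k \<alpha>) (Q \<alpha>) = 0" using \<alpha> by (simp add: mean)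
      then have "Q \<alpha> = y"
        using normal_generator_pos_iff[OF gen[OF \<alpha>(1) yU] assms(1) yU between(3)[OF \<alpha>(1)]]
          normal_generator_neg_iff[OF gen[OF \<alpha>(1) yU] assms(1) yU between(3)[OF \<alpha>(1)]] by auto
      then show ?thesis using \<alpha>(1) by blast
    qed
    have "inj_on Q I" using inc by (metis inj_onI linorder_neqE_linordered_idom order_less_irrefl)
    moreover have "Q ` I = {?m<..<?M}" using between(1,2) hit by auto
    moreover have "mono_on I Q" using inc by (metis less_eq_real_def mono_onI)
    ultimately show ?thesis unfolding bij_betw_def Q_def[abs_def] by blast
  qed
  then show ?thesis unfolding is_increasing_scale_def is_scale_def by blast
qed

end
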